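(* Let $\alpha\in\mathbb{R}$, $\beta>0$ and $n\in\mathbb{N}_0$. Then for every $k\in\mathbb{N}_0$ and all $x\in\Lambda=(0,\infty)$, $$\sum_{\nu=0}^{n}(-1)^{\nu}\binom{n}{\nu}\frac{\beta^{2n-2\nu}}{2^{2n-2\nu}}\,x^{-\alpha}\,\partial_x^{\nu}\Big(x^{\alpha+n}\,\partial_x^{\nu}l^{\alpha,\beta}_k(x)\Big)=\frac{\beta^{n}}{2^{n}}\,\lambda^{\alpha}_{k,n}\,l^{\alpha,\beta}_k(x),$$ where the numbers $\lambda^{\alpha}_{k,n}$ satisfy the recurrence relation $$\lambda^{\alpha}_{k,0}=1,\qquad \lambda^{\alpha}_{k,n}=(k+\alpha+1)\,\lambda^{\alpha+1}_{k,n-1}+k\,\lambda^{\alpha+1}_{k-1,n-1},\qquad n\ge 1,\ k\ge 0$$ (for $k=0$ the last term is $0$).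
   Context: $\mathbb{N}_0$ denotes the nonnegative integers. For $a\in\mathbb{R}$ and $n\in\mathbb{N}_0$ let $(a)_n=a(a+1)\cdots(a+n-1)$, with $(a)_0=1$. For any $\alpha\in\mathbb{R}$ the generalized Laguerre polynomials are $$\mathcal{L}^{\alpha}_k(x)=\sum_{\nu=0}^{k}\frac{(\alpha+\nu+1)_{k-\nu}}{(k-\nu)!\,\nu!}(-x)^{\nu},\qquad k\ge 0.$$ For $\alpha\in\mathbb{R}$, $\beta>0$ the generalized Laguerre functions are $l^{\alpha,\beta}_k(x)=e^{-\frac12\beta x}\mathcal{L}^{\alpha}_k(\beta x)$, $k\ge0$. $\partial_x^{\nu}$ denotes the $\nu$-th derivative in $x$. *)

theory Defs
  imports "HOL-Analysis.Analysis"
begin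

definition gen_laguerre_poly :: "real \<Rightarrow> nat \<Rightarrow> real \<Rightarrow> real" where
  "gen_laguerre_poly \<alpha> k x =
     (\<Sum>\<nu>=0..k. pochhammer (\<alpha> + real \<nu> + 1) (k - \<nu>) / (fact (k - \<nu>) * fact \<nu>) * (- x) ^ \<nu>)"

definition gen_laguerre_fun :: "real \<Rightarrow> real \<Rightarrow> nat \<Rightarrow> real \<Rightarrow> real" where
  "gen_laguerre_fun \<alpha> \<beta> k x = exp (- (1 / 2) * \<beta> * x) * gen_laguerre_poly \<alpha> k (\<beta> * x)"

(* For k = 0 the truncated index k - 1 is harmless: that term carries the factor real k = 0. *)
primrec laguerre_eigenvalue :: "real \<Rightarrow> nat \<Rightarrow> nat \<Rightarrow> real" where
  "laguerre_eigenvalue \<alpha> k 0 = 1"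
| "laguerre_eigenvalue \<alpha> k (Suc n) =
     (real k + \<alpha> + 1) * laguerre_eigenvalue (\<alpha> + 1) k n
     + real k * laguerre_eigenvalue (\<alpha> + 1) (k - 1) n"

end

theory Submission
  imports Defs
begin

text \<open>
  Put \<open>c = \<beta>/2\<close> and, for a smooth function \<open>f\<close> on the positive half-line,
  \<open>S\<^sub>n\<^sub>,\<^sub>a f = \<Sum>\<^sub>\<nu> (-1)\<^sup>\<nu> (n choose \<nu>) c\<^bsup>2(n-\<nu>)\<^esup> \<partial>\<^sup>\<nu>(x\<^sup>a \<partial>\<^sup>\<nu> f)\<close>.
  The claim says that \<open>S\<^sub>n\<^sub>,\<^sub>a\<close> with \<open>a = \<alpha> + n\<close> maps the Laguerre function \<open>l\<^sub>k\<^sup>\<alpha>\<close> to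
  \<open>c\<^sup>n \<lambda>\<close> times \<open>x\<^sup>\<alpha> l\<^sub>k\<^sup>\<alpha>\<close>. It is proved by induction on \<open>n\<close>, for all \<open>\<alpha>\<close> and
  \<open>k\<close> at once.

  Pascal's rule for the binomial coefficients gives a recursion in which \<open>a\<close> stays the same
  (\<open>sym_diff_op_Suc\<close>):
  \<open>S\<^bsub>n+1,a\<^esub> f = c\<^sup>2 S\<^sub>n\<^sub>,\<^sub>a f - (S\<^sub>n\<^sub>,\<^sub>a f')'\<close>.
  Since \<open>\<alpha> + (n + 1) = (\<alpha> + 1) + n\<close>, the induction hypothesis for \<open>S\<^sub>n\<^sub>,\<^sub>a\<close> concerns the parameter
  \<open>\<alpha> + 1\<close>. With \<open>p = l\<^sub>k\<^bsup>\<alpha>+1\<^esup>\<close> and \<open>q = l\<^bsub>k-1\<^esub>\<^bsup>\<alpha>+1\<^esup>\<close>, where \<open>q = 0\<close> for \<open>k = 0\<close>, both inputs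
  of the recursion are combinations of functions to which it applies:
  \<open>l\<^sub>k\<^sup>\<alpha> = p - q\<close> and \<open>\<partial> l\<^sub>k\<^sup>\<alpha> = -c (p + q)\<close>.

  If \<open>A\<close> and \<open>B\<close> are the eigenvalues belonging to \<open>p\<close> and \<open>q\<close>, the recursion therefore yields
  \<open>c\<^bsup>n+1\<^esup>\<close> times \<open>A (c x\<^bsup>\<alpha>+1\<^esup> p + (x\<^bsup>\<alpha>+1\<^esup> p)') + B (- c x\<^bsup>\<alpha>+1\<^esup> q + (x\<^bsup>\<alpha>+1\<^esup> q)')\<close>.
  The two brackets are \<open>(k + \<alpha> + 1) x\<^sup>\<alpha> l\<^sub>k\<^sup>\<alpha>\<close> and \<open>k x\<^sup>\<alpha> l\<^sub>k\<^sup>\<alpha>\<close> (\<open>laguerre_fun_raise\<close> and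
  \<open>prev_laguerre_fun_raise\<close>), which is exactly the recurrence of the eigenvalues. All the
  relations between Laguerre functions reduce to coefficientwise identities between
  binomial coefficients with real upper argument. The recursion and the linearity of \<open>S\<^sub>n\<^sub>,\<^sub>a\<close>
  require higher derivatives to be additive, and hence a notion of smoothness.
\<close>

section \<open>Higher derivatives on an open set\<close>

text \<open>Openness of \<open>S\<close> makes equality on \<open>S\<close> an equality of germs, which derivatives respect. Identities
  on the half-line can thus be differentiated even if they fail off it.\<close>

lemma higher_deriv_cong:
  assumes "open S" "\<And>x. x \<in> S \<Longrightarrow> f x = g x" "x \<in> S"
  shows "(deriv ^^ n) f x = (deriv ^^ n) g x"
  using assms(3)
proof (induction n arbitrary: x)
  case 0
  then show ?case using assms(2) by simp
next
  case (Suc n)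
  have "eventually (\<lambda>y. (deriv ^^ n) f y = (deriv ^^ n) g y) (nhds x)"
    using eventually_nhds_in_open[OF assms(1) Suc.prems] by eventually_elim (rule Suc.IH)
  then show ?case by (simp add: deriv_cong_ev)
qed

text \<open>Finite orders of differentiability are what makes the product rule provable by induction: the
  derivative of a product again contains the undifferentiated factors, about which a lower order is
  still known.\<close>

definition times_differentiable_on :: "nat \<Rightarrow> 'a::real_normed_field set \<Rightarrow> ('a \<Rightarrow> 'a) \<Rightarrow> bool"
  where "times_differentiable_on m S f \<longleftrightarrow>
           (\<forall>i<m. \<forall>x\<in>S. (deriv ^^ i) f field_differentiable at x)"

definition smooth_on :: "'a::real_normed_field set \<Rightarrow> ('a \<Rightarrow> 'a) \<Rightarrow> bool"
  where "smooth_on S f \<longleftrightarrow> (\<forall>m. times_differentiable_on m S f)"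

lemma times_differentiable_on_0: "times_differentiable_on 0 S f"
  by (simp add: times_differentiable_on_def)

lemma times_differentiable_on_Suc:
  "times_differentiable_on (Suc m) S f \<longleftrightarrow>
     (\<forall>x\<in>S. f field_differentiable at x) \<and> times_differentiable_on m S (deriv f)"
  unfolding times_differentiable_on_def All_less_Suc2 by (simp add: funpow_Suc_right del: funpow.simps(2))

lemma times_differentiable_on_SucD:
  "times_differentiable_on (Suc m) S f \<Longrightarrow> times_differentiable_on m S f"
  by (simp add: times_differentiable_on_def)

lemma times_differentiable_on_cong:
  assumes "open S" "\<And>x. x \<in> S \<Longrightarrow> f x = g x"
  shows "times_differentiable_on m S f \<longleftrightarrow> times_differentiable_on m S g"
proof -
  have "(deriv ^^ i) f field_differentiable at x \<longleftrightarrow> (deriv ^^ i) g field_differentiable at x"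
    if "x \<in> S" for i x
  proof -
    have "eventually (\<lambda>y. (deriv ^^ i) f y = (deriv ^^ i) g y) (nhds x)"
      using eventually_nhds_in_open[OF assms(1) that]
      by eventually_elim (rule higher_deriv_cong[OF assms])
    then show ?thesis
      unfolding field_differentiable_def by (intro ex_cong1 DERIV_cong_ev) auto
  qed
  then show ?thesis by (simp add: times_differentiable_on_def)
qed

text \<open>This lets a function be shown smooth by finding a family that is closed under differentiation
  on \<open>S\<close>: only a formula for the derivative on \<open>S\<close> is needed, while \<open>deriv f\<close> may be
  anything elsewhere.\<close>

lemma times_differentiable_on_SucI:
  assumes "open S" "\<And>x. x \<in> S \<Longrightarrow> (f has_field_derivative g x) (at x)"
    "times_differentiable_on m S g"
  shows "times_differentiable_on (Suc m) S f"
proof -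
  have "times_differentiable_on m S (deriv f) \<longleftrightarrow> times_differentiable_on m S g"
    by (rule times_differentiable_on_cong[OF assms(1)]) (rule DERIV_imp_deriv[OF assms(2)])
  then show ?thesis
    using assms(2,3) by (auto simp: times_differentiable_on_Suc field_differentiable_def)
qed

lemma times_differentiable_on_const: "times_differentiable_on m S (\<lambda>x. a)"
  by (induction m arbitrary: a)
    (simp_all add: times_differentiable_on_0 times_differentiable_on_Suc deriv_const[abs_def])

lemma times_differentiable_on_add:
  assumes "open S" "times_differentiable_on m S f" "times_differentiable_on m S g"
  shows "times_differentiable_on m S (\<lambda>x. f x + g x)"
  using assms(2,3)
proof (induction m arbitrary: f g)
  case 0
  show ?case by (rule times_differentiable_on_0)
next
  case (Suc m)
  show ?case
  proof (rule times_differentiable_on_SucI[OF assms(1)])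
    show "((\<lambda>x. f x + g x) has_field_derivative deriv f x + deriv g x) (at x)" if "x \<in> S" for x
      using Suc.prems that
      by (auto simp: times_differentiable_on_Suc DERIV_deriv_iff_field_differentiable intro!: DERIV_add)
    show "times_differentiable_on m S (\<lambda>x. deriv f x + deriv g x)"
      using Suc.prems by (intro Suc.IH) (auto simp: times_differentiable_on_Suc)
  qed
qed

lemma times_differentiable_on_mult:
  assumes "open S" "times_differentiable_on m S f" "times_differentiable_on m S g"
  shows "times_differentiable_on m S (\<lambda>x. f x * g x)"
  using assms(2,3)
proof (induction m arbitrary: f g)
  case 0
  show ?case by (rule times_differentiable_on_0)
next
  case (Suc m)
  show ?case
  proof (rule times_differentiable_on_SucI[OF assms(1)])
    show "((\<lambda>x. f x * g x) has_field_derivative deriv f x * g x + deriv g x * f x) (at x)"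
      if "x \<in> S" for x
      using Suc.prems that
      by (auto simp: times_differentiable_on_Suc DERIV_deriv_iff_field_differentiable intro!: DERIV_mult)
    show "times_differentiable_on m S (\<lambda>x. deriv f x * g x + deriv g x * f x)"
      using Suc.prems times_differentiable_on_SucD
      by (intro times_differentiable_on_add[OF assms(1)] Suc.IH)
        (auto simp: times_differentiable_on_Suc)
  qed
qed

lemma smooth_on_mult:
  "open S \<Longrightarrow> smooth_on S f \<Longrightarrow> smooth_on S g \<Longrightarrow> smooth_on S (\<lambda>x. f x * g x)"
  by (simp add: smooth_on_def times_differentiable_on_mult)

lemma smooth_on_const: "smooth_on S (\<lambda>x. a)"
  by (simp add: smooth_on_def times_differentiable_on_const)

lemma smooth_on_higher_deriv:
  assumes "smooth_on S f"
  shows "smooth_on S ((deriv ^^ n) f)"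
proof (induction n)
  case 0
  show ?case using assms by simp
next
  case (Suc n)
  then show ?case by (simp add: smooth_on_def) (metis times_differentiable_on_Suc)
qed

lemma smooth_on_imp_has_deriv:
  assumes "smooth_on S f" "x \<in> S"
  shows "((deriv ^^ n) f has_field_derivative (deriv ^^ Suc n) f x) (at x)"
  using assms
  by (auto simp: smooth_on_def times_differentiable_on_def DERIV_deriv_iff_field_differentiable)

lemma higher_deriv_linear:
  assumes "open S" "smooth_on S f" "smooth_on S g" "x \<in> S"
  shows "(deriv ^^ n) (\<lambda>y. a * f y + b * g y) x = a * (deriv ^^ n) f x + b * (deriv ^^ n) g x"
  using assms(4)
proof (induction n arbitrary: x)
  case 0
  show ?case by simp
next
  case (Suc n)
  have "eventually (\<lambda>y. (deriv ^^ n) (\<lambda>y. a * f y + b * g y) y =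
          a * (deriv ^^ n) f y + b * (deriv ^^ n) g y) (nhds x)"
    using eventually_nhds_in_open[OF assms(1) Suc.prems] by eventually_elim (rule Suc.IH)
  then have "(deriv ^^ Suc n) (\<lambda>y. a * f y + b * g y) x =
      deriv (\<lambda>y. a * (deriv ^^ n) f y + b * (deriv ^^ n) g y) x"
    by (simp add: deriv_cong_ev)
  also have "\<dots> = a * (deriv ^^ Suc n) f x + b * (deriv ^^ Suc n) g x"
    using smooth_on_imp_has_deriv[OF assms(2) Suc.prems] smooth_on_imp_has_deriv[OF assms(3) Suc.prems]
    by (intro DERIV_imp_deriv DERIV_add DERIV_cmult)
  finally show ?case .
qed

lemma smooth_on_powr: "smooth_on {0<..} (\<lambda>y::real. y powr a)"
  unfolding smooth_on_def
proof
  fix m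
  show "times_differentiable_on m {0<..} (\<lambda>y::real. y powr a)"
  proof (induction m arbitrary: a)
    case 0
    show ?case by (rule times_differentiable_on_0)
  next
    case (Suc m)
    show ?case
    proof (rule times_differentiable_on_SucI)
      show "times_differentiable_on m {0<..} (\<lambda>y::real. a * y powr (a - 1))"
        by (intro times_differentiable_on_mult times_differentiable_on_const Suc.IH) simp
    qed (auto intro!: has_real_derivative_powr)
  qed
qed

section \<open>The symmetric differential operator\<close>

text \<open>The power \<open>a\<close> is a parameter separate from the order \<open>n\<close>, and the factor \<open>x\<^bsup>-\<alpha>\<^esup>\<close> is left out:
  in this normalisation the recursion in \<open>n\<close> keeps the weight \<open>x\<^sup>a\<close> fixed and involves no division by
  powers.\<close>

definition sym_diff_op :: "real \<Rightarrow> real \<Rightarrow> nat \<Rightarrow> (real \<Rightarrow> real) \<Rightarrow> real \<Rightarrow> real" where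
  "sym_diff_op c a n f x =
     (\<Sum>\<nu>\<le>n. (-1) ^ \<nu> * real (n choose \<nu>) * c ^ (2 * (n - \<nu>))
        * (deriv ^^ \<nu>) (\<lambda>y. y powr a * (deriv ^^ \<nu>) f y) x)"

text \<open>Pascal's rule, summed against arbitrary weights.\<close>

lemma sum_choose_Suc:
  fixes g :: "nat \<Rightarrow> 'a::comm_semiring_1"
  shows "(\<Sum>\<nu>\<le>Suc n. of_nat (Suc n choose \<nu>) * g \<nu>) =
         (\<Sum>\<nu>\<le>n. of_nat (n choose \<nu>) * (g \<nu> + g (Suc \<nu>)))"
proof -
  have "(\<Sum>\<nu>\<le>n. of_nat (n choose \<nu>) * g \<nu>) = (\<Sum>\<nu>\<le>Suc n. of_nat (n choose \<nu>) * g \<nu>)"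
    by (simp add: binomial_eq_0)
  also have "\<dots> = g 0 + (\<Sum>\<nu>\<le>n. of_nat (n choose Suc \<nu>) * g (Suc \<nu>))"
    by (subst sum.atMost_Suc_shift) simp
  finally show ?thesis
    by (subst sum.atMost_Suc_shift) (simp add: sum.distrib algebra_simps)
qed

text \<open>Pascal's rule splits the \<open>\<nu>\<close>-th term of order \<open>n + 1\<close> in two. One part keeps \<open>\<nu>\<close> and gains the
  factor \<open>c\<^sup>2\<close>. The other has \<open>\<nu> + 1\<close> in place of \<open>\<nu>\<close>: one of the additional derivatives falls on \<open>f\<close>,
  the other can be pulled out of the whole sum, and the sign changes.\<close>

lemma sym_diff_op_Suc:
  assumes "smooth_on {0<..} f" "x > 0"
  shows "sym_diff_op c a (Suc n) f x =
         c\<^sup>2 * sym_diff_op c a n f x - deriv (sym_diff_op c a n (deriv f)) x"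
proof -
  define u where "u \<nu> = (deriv ^^ \<nu>) (\<lambda>y. y powr a * (deriv ^^ \<nu>) f y) x" for \<nu>
  define g where "g \<nu> = (-1) ^ \<nu> * c ^ (2 * (Suc n - \<nu>)) * u \<nu>" for \<nu>
  have sm: "smooth_on {0<..} (\<lambda>y. y powr a * (deriv ^^ \<nu>) (deriv f) y)" for \<nu>
    using smooth_on_higher_deriv[OF assms(1), of "Suc \<nu>"]
    by (intro smooth_on_mult smooth_on_powr) (simp_all add: funpow_Suc_right del: funpow.simps(2))
  have "(sym_diff_op c a n (deriv f) has_field_derivative
      (\<Sum>\<nu>\<le>n. (-1) ^ \<nu> * real (n choose \<nu>) * c ^ (2 * (n - \<nu>)) * u (Suc \<nu>))) (at x)"
    unfolding sym_diff_op_def[abs_def] u_def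
    using smooth_on_imp_has_deriv[OF sm, of x] assms(2)
    by (intro DERIV_sum DERIV_cmult) (simp add: funpow_swap1)
  then have d: "deriv (sym_diff_op c a n (deriv f)) x =
      (\<Sum>\<nu>\<le>n. (-1) ^ \<nu> * real (n choose \<nu>) * c ^ (2 * (n - \<nu>)) * u (Suc \<nu>))"
    by (rule DERIV_imp_deriv)
  have "sym_diff_op c a (Suc n) f x = (\<Sum>\<nu>\<le>Suc n. of_nat (Suc n choose \<nu>) * g \<nu>)"
    unfolding sym_diff_op_def g_def u_def by (simp only: mult_ac)
  also have "\<dots> = (\<Sum>\<nu>\<le>n. of_nat (n choose \<nu>) * (g \<nu> + g (Suc \<nu>)))"
    by (rule sum_choose_Suc)
  also have "\<dots> = c\<^sup>2 * sym_diff_op c a n f x - deriv (sym_diff_op c a n (deriv f)) x"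
    unfolding d sym_diff_op_def u_def[symmetric] g_def sum_distrib_left sum_subtractf[symmetric]
    by (intro sum.cong refl)
      (simp add: Suc_diff_le power_add[symmetric] algebra_simps power2_eq_square)
  finally show ?thesis .
qed

lemma sym_diff_op_linear:
  assumes "smooth_on {0<..} f" "smooth_on {0<..} g" "x > 0"
  shows "sym_diff_op c a n (\<lambda>y. r * f y + s * g y) x =
         r * sym_diff_op c a n f x + s * sym_diff_op c a n g x"
proof -
  have "(deriv ^^ \<nu>) (\<lambda>y. y powr a * (deriv ^^ \<nu>) (\<lambda>y. r * f y + s * g y) y) x =
        (deriv ^^ \<nu>) (\<lambda>y. r * (y powr a * (deriv ^^ \<nu>) f y) + s * (y powr a * (deriv ^^ \<nu>) g y)) x" for \<nu>
    by (rule higher_deriv_cong[of "{0<..}"])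
      (simp_all add: higher_deriv_linear[OF _ assms(1,2)] assms(3) algebra_simps)
  moreover have "(deriv ^^ \<nu>) (\<lambda>y. r * (y powr a * (deriv ^^ \<nu>) f y) + s * (y powr a * (deriv ^^ \<nu>) g y)) x
      = r * (deriv ^^ \<nu>) (\<lambda>y. y powr a * (deriv ^^ \<nu>) f y) x
      + s * (deriv ^^ \<nu>) (\<lambda>y. y powr a * (deriv ^^ \<nu>) g y) x" for \<nu>
    using assms(3)
    by (intro higher_deriv_linear[of "{0<..}"] smooth_on_mult smooth_on_powr smooth_on_higher_deriv assms) auto
  ultimately show ?thesis
    unfolding sym_diff_op_def by (simp add: sum_distrib_left sum.distrib algebra_simps)
qed

section \<open>Contiguity relations of the Laguerre polynomials\<close>

text \<open>The polynomial of index \<open>k - 1\<close> with the convention \<open>L\<^bsub>-1\<^esub> = 0\<close>. Truncated subtraction would give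
  \<open>L\<^sub>0 = 1\<close> at \<open>k = 0\<close> instead, and the contiguity relations would fail there.\<close>

definition prev_laguerre_poly :: "real \<Rightarrow> nat \<Rightarrow> real \<Rightarrow> real" where
  "prev_laguerre_poly \<alpha> k y = (case k of 0 \<Rightarrow> 0 | Suc j \<Rightarrow> gen_laguerre_poly \<alpha> j y)"

text \<open>In this form the relations between Laguerre polynomials become the standard identities for
  binomial coefficients: Pascal's rule, absorption and its companion.\<close>

lemma gen_laguerre_poly_gbinomial:
  "gen_laguerre_poly \<alpha> k y =
     (\<Sum>\<nu>\<le>k. ((\<alpha> + real k) gchoose (k - \<nu>)) / fact \<nu> * (- y) ^ \<nu>)"
  unfolding gen_laguerre_poly_def atLeast0AtMost
  by (intro sum.cong refl) (simp add: gbinomial_pochhammer' algebra_simps of_nat_diff)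

lemma gen_laguerre_poly_diff:
  "gen_laguerre_poly \<alpha> k y = gen_laguerre_poly (\<alpha> + 1) k y - prev_laguerre_poly (\<alpha> + 1) k y"
proof (cases k)
  case 0
  then show ?thesis by (simp add: gen_laguerre_poly_gbinomial prev_laguerre_poly_def)
next
  case (Suc j)
  have "((\<alpha> + 1 + real (Suc j)) gchoose (Suc j - \<nu>)) =
        ((\<alpha> + real (Suc j)) gchoose (Suc j - \<nu>)) + ((\<alpha> + 1 + real j) gchoose (j - \<nu>))"
    if "\<nu> \<le> j" for \<nu>
    using that gbinomial_Suc_Suc[of "\<alpha> + real (Suc j)" "j - \<nu>"]
    by (simp add: Suc_diff_le add_ac)
  then show ?thesis
    unfolding Suc prev_laguerre_poly_def gen_laguerre_poly_gbinomial
    by (simp add: sum.distrib algebra_simps add_divide_distrib)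
qed

text \<open>As \<open>L\<^sub>k\<^sup>\<alpha>\<close> has derivative \<open>- L\<^bsub>k-1\<^esub>\<^bsup>\<alpha>+1\<^esup>\<close>, the left-hand side is the Euler operator \<open>y \<partial>\<^sub>y\<close> applied to
  \<open>L\<^sub>k\<^sup>\<alpha>\<close>, which multiplies the coefficient of degree \<open>\<nu>\<close> by \<open>\<nu>\<close>. The two relations below are
  compared coefficientwise by means of it.\<close>

lemma mult_prev_laguerre_poly:
  "- y * prev_laguerre_poly (\<alpha> + 1) k y =
     (\<Sum>\<nu>\<le>k. real \<nu> * (((\<alpha> + real k) gchoose (k - \<nu>)) / fact \<nu> * (- y) ^ \<nu>))"
proof (cases k)
  case 0
  then show ?thesis by (simp add: prev_laguerre_poly_def)
next
  case (Suc j)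
  have "real (Suc \<nu>) * (((\<alpha> + real (Suc j)) gchoose (Suc j - Suc \<nu>)) / fact (Suc \<nu>) * (- y) ^ Suc \<nu>)
        = - y * (((\<alpha> + 1 + real j) gchoose (j - \<nu>)) / fact \<nu> * (- y) ^ \<nu>)" for \<nu>
  proof -
    have "real (Suc \<nu>) / fact (Suc \<nu>) = 1 / fact \<nu>"
      by (simp add: field_simps del: of_nat_Suc)
    then show ?thesis
      by (simp add: field_simps del: of_nat_Suc fact_Suc) (simp add: add_ac)
  qed
  then show ?thesis
    unfolding Suc prev_laguerre_poly_def gen_laguerre_poly_gbinomial
    by (subst sum.atMost_Suc_shift) (simp add: sum_distrib_left add.assoc del: fact_Suc)
qed

lemma has_field_derivative_gen_laguerre_poly:
  "(gen_laguerre_poly \<alpha> k has_field_derivative - prev_laguerre_poly (\<alpha> + 1) k y) (at y)"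
proof (cases k)
  case 0
  have "gen_laguerre_poly \<alpha> 0 = (\<lambda>y. 1)"
    by (auto simp: gen_laguerre_poly_gbinomial)
  then show ?thesis by (simp add: 0 prev_laguerre_poly_def)
next
  case (Suc j)
  let ?c = "\<lambda>\<nu>. ((\<alpha> + real k) gchoose (k - \<nu>)) / fact \<nu>"
  have "(gen_laguerre_poly \<alpha> k has_field_derivative
          (\<Sum>\<nu>\<le>k. ?c \<nu> * (real \<nu> * (- 1 * (- y) ^ (\<nu> - 1))))) (at y)"
    unfolding gen_laguerre_poly_gbinomial[abs_def]
    by (intro DERIV_sum DERIV_cmult) (auto intro!: derivative_eq_intros)
  also have "(\<Sum>\<nu>\<le>k. ?c \<nu> * (real \<nu> * (- 1 * (- y) ^ (\<nu> - 1)))) =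
      (\<Sum>\<nu>\<le>j. ?c (Suc \<nu>) * (real (Suc \<nu>) * (- 1 * (- y) ^ \<nu>)))"
    unfolding Suc by (subst sum.atMost_Suc_shift) simp
  also have "\<dots> = - prev_laguerre_poly (\<alpha> + 1) k y"
  proof -
    have "?c (Suc \<nu>) * (real (Suc \<nu>) * (- 1 * (- y) ^ \<nu>)) =
          - (((\<alpha> + 1 + real j) gchoose (j - \<nu>)) / fact \<nu> * (- y) ^ \<nu>)" for \<nu>
    proof -
      have "real (Suc \<nu>) / fact (Suc \<nu>) = 1 / fact \<nu>"
        by (simp add: field_simps del: of_nat_Suc)
      then show ?thesis
        by (simp add: Suc field_simps del: of_nat_Suc fact_Suc) (simp add: add_ac)
    qed
    then show ?thesis
      by (simp add: Suc prev_laguerre_poly_def gen_laguerre_poly_gbinomial sum_negf add.assoc)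
  qed
  finally show ?thesis .
qed

text \<open>This is \<open>(\<alpha> + 1 + y \<partial>\<^sub>y) L\<^sub>k\<^bsup>\<alpha>+1\<^esup> = (k + \<alpha> + 1) L\<^sub>k\<^sup>\<alpha>\<close>, so in degree \<open>\<nu>\<close> the coefficient of
  \<open>L\<^sub>k\<^bsup>\<alpha>+1\<^esup>\<close> is multiplied by \<open>\<alpha> + 1 + \<nu>\<close>.\<close>

lemma laguerre_raise:
  "(\<alpha> + 1) * gen_laguerre_poly (\<alpha> + 1) k y - y * prev_laguerre_poly (\<alpha> + 2) k y =
     (real k + \<alpha> + 1) * gen_laguerre_poly \<alpha> k y"
proof -
  let ?b = "\<lambda>\<nu>. (\<alpha> + 1 + real k) gchoose (k - \<nu>)"
  have eq: "(\<alpha> + 1 + real \<nu>) * ?b \<nu> = (real k + \<alpha> + 1) * ((\<alpha> + real k) gchoose (k - \<nu>))"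
    if "\<nu> \<le> k" for \<nu>
    using that gbinomial_absorb_comp[of "\<alpha> + 1 + real k" "k - \<nu>"]
    by (simp add: of_nat_diff algebra_simps)
  have shift: "\<alpha> + 1 + 1 = \<alpha> + 2" by simp
  have "(\<alpha> + 1) * gen_laguerre_poly (\<alpha> + 1) k y - y * prev_laguerre_poly (\<alpha> + 2) k y =
      (\<Sum>\<nu>\<le>k. (\<alpha> + 1) * (?b \<nu> / fact \<nu> * (- y) ^ \<nu>))
      + (\<Sum>\<nu>\<le>k. real \<nu> * (?b \<nu> / fact \<nu> * (- y) ^ \<nu>))"
    using mult_prev_laguerre_poly[of y "\<alpha> + 1" k, unfolded shift]
    by (simp add: gen_laguerre_poly_gbinomial sum_distrib_left)
  also have "\<dots> = (\<Sum>\<nu>\<le>k. ((\<alpha> + 1 + real \<nu>) * ?b \<nu>) * ((- y) ^ \<nu> / fact \<nu>))"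
    unfolding sum.distrib[symmetric]
    by (intro sum.cong refl) (simp add: distrib_right add_divide_distrib)
  also have "\<dots> = (\<Sum>\<nu>\<le>k. ((real k + \<alpha> + 1) * ((\<alpha> + real k) gchoose (k - \<nu>))) * ((- y) ^ \<nu> / fact \<nu>))"
    by (intro sum.cong refl) (simp only: eq atMost_iff)
  also have "\<dots> = (real k + \<alpha> + 1) * gen_laguerre_poly \<alpha> k y"
    by (simp add: gen_laguerre_poly_gbinomial sum_distrib_left mult.assoc)
  finally show ?thesis .
qed

text \<open>In degree \<open>\<nu>\<close> split the factor \<open>k = j + 1\<close> as \<open>\<nu> + (k - \<nu>)\<close>. The first summand is the Euler operator,
  that is, the last term on the right; the second is absorbed into the binomial coefficient and lowers
  the index.\<close>

lemma laguerre_three_term: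
  "real (Suc j) * gen_laguerre_poly \<alpha> (Suc j) y =
     (\<alpha> + real (Suc j)) * gen_laguerre_poly \<alpha> j y - y * gen_laguerre_poly (\<alpha> + 1) j y"
proof -
  let ?b = "\<lambda>\<nu>. (\<alpha> + real (Suc j)) gchoose (Suc j - \<nu>)"
  have eq: "real (Suc j - \<nu>) * ?b \<nu> = (\<alpha> + real (Suc j)) * ((\<alpha> + real j) gchoose (j - \<nu>))"
    if "\<nu> \<le> j" for \<nu>
    using that gbinomial_absorption[of "j - \<nu>" "\<alpha> + real (Suc j)"]
    by (simp add: Suc_diff_le algebra_simps)
  have "real (Suc j) * gen_laguerre_poly \<alpha> (Suc j) y =
      (\<Sum>\<nu>\<le>Suc j. real \<nu> * (?b \<nu> / fact \<nu> * (- y) ^ \<nu>)) +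
      (\<Sum>\<nu>\<le>Suc j. (real (Suc j - \<nu>) * ?b \<nu>) * ((- y) ^ \<nu> / fact \<nu>))"
    unfolding gen_laguerre_poly_gbinomial sum_distrib_left sum.distrib[symmetric]
  proof (intro sum.cong refl)
    fix \<nu> assume "\<nu> \<in> {..Suc j}"
    then have "real (Suc j) = real \<nu> + real (Suc j - \<nu>)" by auto
    then show "real (Suc j) * (?b \<nu> / fact \<nu> * (- y) ^ \<nu>) =
      real \<nu> * (?b \<nu> / fact \<nu> * (- y) ^ \<nu>) + real (Suc j - \<nu>) * ?b \<nu> * ((- y) ^ \<nu> / fact \<nu>)"
      by (metis (no_types, lifting) distrib_right mult.assoc times_divide_eq_left times_divide_eq_right)
  qed
  also have "(\<Sum>\<nu>\<le>Suc j. (real (Suc j - \<nu>) * ?b \<nu>) * ((- y) ^ \<nu> / fact \<nu>)) =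
      (\<Sum>\<nu>\<le>j. ((\<alpha> + real (Suc j)) * ((\<alpha> + real j) gchoose (j - \<nu>))) * ((- y) ^ \<nu> / fact \<nu>))"
    using eq by (simp del: of_nat_Suc)
  also have "\<dots> = (\<alpha> + real (Suc j)) * gen_laguerre_poly \<alpha> j y"
    by (simp add: gen_laguerre_poly_gbinomial sum_distrib_left mult.assoc)
  finally show ?thesis
    using mult_prev_laguerre_poly[of y \<alpha> "Suc j"] by (simp add: prev_laguerre_poly_def)
qed

section \<open>Contiguity relations of the Laguerre functions\<close>

definition prev_laguerre_fun :: "real \<Rightarrow> real \<Rightarrow> nat \<Rightarrow> real \<Rightarrow> real" where
  "prev_laguerre_fun \<alpha> \<beta> k x = (case k of 0 \<Rightarrow> 0 | Suc j \<Rightarrow> gen_laguerre_fun \<alpha> \<beta> j x)"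

lemma prev_laguerre_fun_eq:
  "prev_laguerre_fun \<alpha> \<beta> k x = exp (- (1 / 2) * \<beta> * x) * prev_laguerre_poly \<alpha> k (\<beta> * x)"
  by (cases k) (simp_all add: prev_laguerre_fun_def prev_laguerre_poly_def gen_laguerre_fun_def)

lemma gen_laguerre_fun_diff:
  "gen_laguerre_fun \<alpha> \<beta> k x = gen_laguerre_fun (\<alpha> + 1) \<beta> k x - prev_laguerre_fun (\<alpha> + 1) \<beta> k x"
  unfolding gen_laguerre_fun_def prev_laguerre_fun_eq
  by (subst gen_laguerre_poly_diff) (simp add: algebra_simps)

lemma has_field_derivative_gen_laguerre_fun_prev:
  "(gen_laguerre_fun \<alpha> \<beta> k has_field_derivative
     - (\<beta> / 2) * gen_laguerre_fun \<alpha> \<beta> k x - \<beta> * prev_laguerre_fun (\<alpha> + 1) \<beta> k x) (at x)"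
  unfolding gen_laguerre_fun_def[abs_def] prev_laguerre_fun_eq
  by (rule derivative_eq_intros refl DERIV_chain2[OF has_field_derivative_gen_laguerre_poly])+
    (simp add: algebra_simps)

text \<open>Replacing the undifferentiated \<open>l\<^sub>k\<^sup>\<alpha>\<close> by \<open>p - q\<close> symmetrises the derivative to
  \<open>- (\<beta>/2) (p + q)\<close>, an expression in functions of parameter \<open>\<alpha> + 1\<close> alone.\<close>

lemma has_field_derivative_gen_laguerre_fun:
  "(gen_laguerre_fun \<alpha> \<beta> k has_field_derivative
     - (\<beta> / 2) * (gen_laguerre_fun (\<alpha> + 1) \<beta> k x + prev_laguerre_fun (\<alpha> + 1) \<beta> k x)) (at x)"
  using has_field_derivative_gen_laguerre_fun_prev[of \<alpha> \<beta> k x] gen_laguerre_fun_diff[of \<alpha> \<beta> k x]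
  by (simp add: algebra_simps)

text \<open>The Laguerre functions of fixed \<open>\<beta>\<close> and all \<open>\<alpha>\<close> span a space closed under differentiation.\<close>

lemma smooth_on_gen_laguerre_fun:
  assumes "open S"
  shows "smooth_on S (gen_laguerre_fun \<alpha> \<beta> k)"
  unfolding smooth_on_def
proof
  fix m
  show "times_differentiable_on m S (gen_laguerre_fun \<alpha> \<beta> k)"
  proof (induction m arbitrary: \<alpha> k)
    case 0
    show ?case by (rule times_differentiable_on_0)
  next
    case (Suc m)
    have "times_differentiable_on m S (prev_laguerre_fun (\<alpha> + 1) \<beta> k)"
      by (cases k) (simp_all add: prev_laguerre_fun_def[abs_def] times_differentiable_on_const Suc.IH)
    then show ?case
      by (intro times_differentiable_on_SucI[OF assms has_field_derivative_gen_laguerre_fun]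
          times_differentiable_on_mult times_differentiable_on_add times_differentiable_on_const
          Suc.IH assms)
  qed
qed

lemma smooth_on_prev_laguerre_fun:
  "open S \<Longrightarrow> smooth_on S (prev_laguerre_fun \<alpha> \<beta> k)"
  by (cases k)
    (simp_all add: prev_laguerre_fun_def[abs_def] smooth_on_const smooth_on_gen_laguerre_fun)

text \<open>The exponential contributes \<open>- (\<beta>/2) x\<^bsup>\<alpha>+1\<^esup> l\<^sub>k\<^bsup>\<alpha>+1\<^esup>\<close> to the derivative; what remains is the relation
  \<open>laguerre_raise\<close> at \<open>\<beta> x\<close>.\<close>

lemma laguerre_fun_raise:
  assumes "x > 0"
  shows "((\<lambda>y. y powr (\<alpha> + 1) * gen_laguerre_fun (\<alpha> + 1) \<beta> k y) has_field_derivative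
     x powr \<alpha> * ((real k + \<alpha> + 1) * gen_laguerre_fun \<alpha> \<beta> k x
                   - \<beta> / 2 * x * gen_laguerre_fun (\<alpha> + 1) \<beta> k x)) (at x)"
proof -
  have shift: "\<alpha> + 1 + 1 = \<alpha> + 2" by simp
  have "((\<lambda>y. y powr (\<alpha> + 1) * gen_laguerre_fun (\<alpha> + 1) \<beta> k y) has_field_derivative
      (\<alpha> + 1) * x powr \<alpha> * gen_laguerre_fun (\<alpha> + 1) \<beta> k x
      + (- (\<beta> / 2) * gen_laguerre_fun (\<alpha> + 1) \<beta> k x - \<beta> * prev_laguerre_fun (\<alpha> + 2) \<beta> k x)
        * x powr (\<alpha> + 1)) (at x)"
    using has_real_derivative_powr[OF assms, of "\<alpha> + 1"]
      has_field_derivative_gen_laguerre_fun_prev[of "\<alpha> + 1" \<beta> k x, unfolded shift]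
    by (intro DERIV_mult) simp_all
  also have "x powr (\<alpha> + 1) = x powr \<alpha> * x"
    using assms by (simp add: powr_add)
  also have "(\<alpha> + 1) * x powr \<alpha> * gen_laguerre_fun (\<alpha> + 1) \<beta> k x
      + (- (\<beta> / 2) * gen_laguerre_fun (\<alpha> + 1) \<beta> k x - \<beta> * prev_laguerre_fun (\<alpha> + 2) \<beta> k x)
        * (x powr \<alpha> * x) =
      x powr \<alpha> * exp (- (1 / 2) * \<beta> * x) * ((\<alpha> + 1) * gen_laguerre_poly (\<alpha> + 1) k (\<beta> * x)
        - \<beta> * x * prev_laguerre_poly (\<alpha> + 2) k (\<beta> * x))
      - x powr \<alpha> * (\<beta> / 2 * x * gen_laguerre_fun (\<alpha> + 1) \<beta> k x)"
    unfolding gen_laguerre_fun_def prev_laguerre_fun_eq by (simp add: algebra_simps)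
  also have "\<dots> = x powr \<alpha> * ((real k + \<alpha> + 1) * gen_laguerre_fun \<alpha> \<beta> k x
                   - \<beta> / 2 * x * gen_laguerre_fun (\<alpha> + 1) \<beta> k x)"
    unfolding laguerre_raise by (simp add: gen_laguerre_fun_def algebra_simps)
  finally show ?thesis .
qed

text \<open>The previous lemma at index \<open>k - 1\<close> leaves \<open>(k + \<alpha>) l\<^bsub>k-1\<^esub>\<^sup>\<alpha>\<close>, which the three-term relation trades for
  \<open>k l\<^sub>k\<^sup>\<alpha> + \<beta> x l\<^bsub>k-1\<^esub>\<^bsup>\<alpha>+1\<^esup>\<close>. The last summand reverses the sign of the \<open>\<beta>/2\<close> term, so that it will
  cancel against \<open>c\<^sup>2 S q\<close> in the recursion for the operator.\<close>

lemma prev_laguerre_fun_raise: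
  assumes "x > 0"
  shows "((\<lambda>y. y powr (\<alpha> + 1) * prev_laguerre_fun (\<alpha> + 1) \<beta> k y) has_field_derivative
     x powr \<alpha> * (real k * gen_laguerre_fun \<alpha> \<beta> k x
                   + \<beta> / 2 * x * prev_laguerre_fun (\<alpha> + 1) \<beta> k x)) (at x)"
proof (cases k)
  case 0
  then show ?thesis by (simp add: prev_laguerre_fun_def)
next
  case (Suc j)
  have "real (Suc j) * gen_laguerre_fun \<alpha> \<beta> (Suc j) x =
      (real j + \<alpha> + 1) * gen_laguerre_fun \<alpha> \<beta> j x - \<beta> * x * gen_laguerre_fun (\<alpha> + 1) \<beta> j x"
    using arg_cong[OF laguerre_three_term[of j \<alpha> "\<beta> * x"], of "(*) (exp (- (1 / 2) * \<beta> * x))"]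
    by (simp add: gen_laguerre_fun_def algebra_simps)
  then have "(real j + \<alpha> + 1) * gen_laguerre_fun \<alpha> \<beta> j x - \<beta> / 2 * x * gen_laguerre_fun (\<alpha> + 1) \<beta> j x =
      real (Suc j) * gen_laguerre_fun \<alpha> \<beta> (Suc j) x + \<beta> / 2 * x * gen_laguerre_fun (\<alpha> + 1) \<beta> j x"
    by (simp add: algebra_simps)
  then show ?thesis
    using laguerre_fun_raise[OF assms, of \<alpha> \<beta> j] by (simp only: Suc prev_laguerre_fun_def nat.case)
qed

section \<open>The eigenvalue relation\<close>

text \<open>The terms with an extra factor \<open>c x\<close> coming from \<open>c\<^sup>2 S l\<close> and from \<open>(S l')'\<close> cancel, for \<open>p\<close> and for
  \<open>q\<close> separately; the remaining multiples of \<open>l\<close> add up to the recurrence of the eigenvalues.\<close>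

lemma sym_diff_op_laguerre:
  assumes "x > 0"
  shows "sym_diff_op (\<beta> / 2) (\<alpha> + real n) n (gen_laguerre_fun \<alpha> \<beta> k) x =
         (\<beta> / 2) ^ n * laguerre_eigenvalue \<alpha> k n * (x powr \<alpha> * gen_laguerre_fun \<alpha> \<beta> k x)"
  using assms
proof (induction n arbitrary: \<alpha> k x)
  case 0
  show ?case by (simp add: sym_diff_op_def)
next
  case (Suc n)
  define c where "c = \<beta> / 2"
  define a where "a = \<alpha> + real (Suc n)"
  define l where "l = gen_laguerre_fun \<alpha> \<beta> k"
  define p where "p = gen_laguerre_fun (\<alpha> + 1) \<beta> k"
  define q where "q = prev_laguerre_fun (\<alpha> + 1) \<beta> k"
  define A where "A = laguerre_eigenvalue (\<alpha> + 1) k n"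
  define B where "B = laguerre_eigenvalue (\<alpha> + 1) (k - 1) n"
  have smooth: "smooth_on {0<..} l" "smooth_on {0<..} p" "smooth_on {0<..} q"
    by (simp_all add: l_def p_def q_def smooth_on_gen_laguerre_fun smooth_on_prev_laguerre_fun)
  have a: "a = \<alpha> + 1 + real n" by (simp add: a_def)
  have p: "sym_diff_op c a n p y = c ^ n * A * (y powr (\<alpha> + 1) * p y)" if "y > 0" for y
    using Suc.IH[OF that] by (simp add: a c_def p_def A_def)
  have q: "sym_diff_op c a n q y = c ^ n * B * (y powr (\<alpha> + 1) * q y)" if "y > 0" for y
  proof (cases k)
    (* B is here an eigenvalue of index 0 that does not belong to q, but both sides vanish. *)
    case 0
    then have "q = (\<lambda>y. 0)" by (auto simp: q_def prev_laguerre_fun_def)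
    then show ?thesis
      using sym_diff_op_linear[of "\<lambda>_. 0" "\<lambda>_. 0" y c a n 0 0] that by (simp add: smooth_on_const)
  next
    case k: (Suc j)
    then have "q = gen_laguerre_fun (\<alpha> + 1) \<beta> j" by (auto simp: q_def prev_laguerre_fun_def)
    then show ?thesis
      using Suc.IH[OF that] by (simp add: a c_def B_def k)
  qed
  have op_l: "sym_diff_op c a n l x = c ^ n * (A * (x powr (\<alpha> + 1) * p x) - B * (x powr (\<alpha> + 1) * q x))"
  proof -
    have "l = (\<lambda>y. 1 * p y + (- 1) * q y)"
      using gen_laguerre_fun_diff[of \<alpha> \<beta> k] by (simp add: fun_eq_iff l_def p_def q_def)
    then have "sym_diff_op c a n l x = 1 * sym_diff_op c a n p x + (- 1) * sym_diff_op c a n q x"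
      by (simp only: sym_diff_op_linear[OF smooth(2,3) Suc.prems])
    then show ?thesis
      unfolding p[OF Suc.prems] q[OF Suc.prems] by (simp add: algebra_simps)
  qed
  have op_l': "sym_diff_op c a n (deriv l) y =
      - (c ^ Suc n) * (A * (y powr (\<alpha> + 1) * p y) + B * (y powr (\<alpha> + 1) * q y))" if "y > 0" for y
  proof -
    have "deriv l = (\<lambda>y. (- c) * p y + (- c) * q y)"
      using DERIV_imp_deriv[OF has_field_derivative_gen_laguerre_fun, of \<alpha> \<beta> k]
      by (simp add: fun_eq_iff l_def p_def q_def c_def distrib_left)
    then have "sym_diff_op c a n (deriv l) y =
        (- c) * sym_diff_op c a n p y + (- c) * sym_diff_op c a n q y"
      by (simp only: sym_diff_op_linear[OF smooth(2,3) that])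
    then show ?thesis
      unfolding p[OF that] q[OF that] by (simp add: algebra_simps)
  qed
  have "deriv (sym_diff_op c a n (deriv l)) x =
      deriv (\<lambda>y. - (c ^ Suc n) * (A * (y powr (\<alpha> + 1) * p y) + B * (y powr (\<alpha> + 1) * q y))) x"
    using Suc.prems
    by (intro deriv_cong_ev refl eventually_mono[OF eventually_nhds_in_open[of "{0<..}" x]] op_l') auto
  also have "\<dots> = - (c ^ Suc n) *
      (A * (x powr \<alpha> * ((real k + \<alpha> + 1) * l x - c * x * p x))
       + B * (x powr \<alpha> * (real k * l x + c * x * q x)))"
    unfolding l_def p_def q_def c_def
    by (intro DERIV_imp_deriv DERIV_cmult DERIV_add laguerre_fun_raise prev_laguerre_fun_raise Suc.prems)
  finally have d: "deriv (sym_diff_op c a n (deriv l)) x = \<dots>" .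
  have "sym_diff_op c a (Suc n) l x =
      c ^ Suc n * ((real k + \<alpha> + 1) * A + real k * B) * (x powr \<alpha> * l x)"
    unfolding sym_diff_op_Suc[OF smooth(1) Suc.prems] op_l d
    using Suc.prems by (simp add: powr_add power2_eq_square algebra_simps)
  then show ?case
    by (simp add: a_def c_def l_def A_def B_def)
qed

theorem lemma6:
  fixes \<alpha> \<beta> x :: real and n k :: nat
  assumes "\<beta> > 0" and "x \<in> {0<..}"
  shows "(\<Sum>\<nu>=0..n. (-1) ^ \<nu> * real (n choose \<nu>) * (\<beta> ^ (2 * n - 2 * \<nu>) / 2 ^ (2 * n - 2 * \<nu>))
            * x powr (- \<alpha>)
            * (deriv ^^ \<nu>) (\<lambda>y. y powr (\<alpha> + real n) * (deriv ^^ \<nu>) (gen_laguerre_fun \<alpha> \<beta> k) y) x)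
         = \<beta> ^ n / 2 ^ n * laguerre_eigenvalue \<alpha> k n * gen_laguerre_fun \<alpha> \<beta> k x"
    (is "?lhs = ?rhs")
proof -
  have x: "x > 0" using assms(2) by simp
  have "?lhs = x powr (- \<alpha>) * sym_diff_op (\<beta> / 2) (\<alpha> + real n) n (gen_laguerre_fun \<alpha> \<beta> k) x"
    by (simp add: sym_diff_op_def sum_distrib_left atLeast0AtMost power_divide
        diff_mult_distrib diff_mult_distrib2 mult_ac)
  also have "\<dots> = ?rhs"
    using x by (simp add: sym_diff_op_laguerre powr_minus power_divide)
  finally show ?thesis .
qed

end
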